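(* Let $\mathcal{G}$ be a finite connected graph with $n \ge 2$ vertices, with discrete gradient $\nabla$ and graph Laplacian $\Delta = \nabla^T\nabla$. Let $0=\omega_1^2 < \omega_2^2 \le \dots \le \omega_n^2$ be the eigenvalues of $\Delta$ and $\mathbf{v}^1,\dots,\mathbf{v}^n$ a corresponding orthonormal basis of eigenvectors. Let $G, L \in \mathbb{R}^n$ (generator and load vectors) be expanded as $G = \sum_{i=1}^n g_i \mathbf{v}^i$, $L = \sum_{i=1}^n l_i \mathbf{v}^i$, and suppose that $P = G - L$ is balanced, i.e. $\sum_{k=1}^n P_k = 0$. Let $\theta\in\mathbb{R}^n$ be a solution of $-\Delta\theta = P$ and let $P_l = \nabla\theta$ be the vector of line powers. Then $$\| P_l \|_2^2 = \sum_{i=2}^n \frac{(g_i - l_i)^2}{\omega_i^2}.$$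
   Context: The graph is simple and undirected with all lines (edges) identical (unit weights); $P_k$ denotes the component of $P$ at vertex $k$ in the canonical basis, and $\|\cdot\|_2$ is the Euclidean norm. Fix an arbitrary orientation of the edges. The discrete gradient $\nabla$ is the matrix with one row per edge and one column per vertex (the transpose of the oriented incidence matrix), with entries in $\{0,\pm 1\}$: the row of an edge with end vertices $a$ and $b$ has one entry $+1$ and one entry $-1$ in columns $a$ and $b$, according to the orientation, and zeros elsewhere. The graph Laplacian is $\Delta = \nabla^T\nabla$, i.e. $\Delta_{ii}$ is the degree of vertex $i$ and, for $i\ne j$, $\Delta_{ij}=-1$ if $i$ and $j$ are adjacent and $0$ otherwise. *)

theory Defs
  imports "HOL-Analysis.Analysis"
begin

(* A simple undirected graph whose vertex set is the whole finite type 'v is given by its set of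
   edges, each edge being its two-element set of end vertices. *)

definition simple_graph :: "'v set set \<Rightarrow> bool"
  where "simple_graph E \<longleftrightarrow> (\<forall>e\<in>E. card e = 2)"

definition adjacent :: "'v set set \<Rightarrow> 'v \<Rightarrow> 'v \<Rightarrow> bool"
  where "adjacent E a b \<longleftrightarrow> {a, b} \<in> E"

definition connected_graph :: "'v set set \<Rightarrow> bool"
  where "connected_graph E \<longleftrightarrow> (\<forall>a b. (adjacent E)\<^sup>*\<^sup>* a b)"

definition vertex_degree :: "'v set set \<Rightarrow> 'v \<Rightarrow> nat"
  where "vertex_degree E a = card {e \<in> E. a \<in> e}"

(* The finite type 'e labels the edges, so that it can index the rows of a matrix: each edge in E
   has exactly one label, and exactly one orientation, from tail to head. *)

definition edge_orientation :: "'v set set \<Rightarrow> ('e \<Rightarrow> 'v) \<Rightarrow> ('e \<Rightarrow> 'v) \<Rightarrow> bool"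
  where "edge_orientation E tail head \<longleftrightarrow> bij_betw (\<lambda>e. {tail e, head e}) UNIV E"

definition gradient :: "('e::finite \<Rightarrow> 'v::finite) \<Rightarrow> ('e \<Rightarrow> 'v) \<Rightarrow> real^'v^'e"
  where "gradient tail head =
    (\<chi> e k. if k = head e then 1 else if k = tail e then -1 else 0)"

definition laplacian :: "('e::finite \<Rightarrow> 'v::finite) \<Rightarrow> ('e \<Rightarrow> 'v) \<Rightarrow> real^'v^'v"
  where "laplacian tail head = transpose (gradient tail head) ** gradient tail head"

definition orthonormal_basis :: "nat \<Rightarrow> (nat \<Rightarrow> 'a::euclidean_space) \<Rightarrow> bool"
  where "orthonormal_basis n v \<longleftrightarrow>
    (\<forall>i\<in>{1..n}. \<forall>j\<in>{1..n}. v i \<bullet> v j = (if i = j then 1 else 0)) \<and>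
    span (v ` {1..n}) = UNIV"

(* The Laplacian depends only on the graph, not on the labelling and orientation of the edges. *)

lemma laplacian_entry:
  fixes tail head :: "'e::finite \<Rightarrow> 'v::finite"
  assumes "simple_graph E" and "edge_orientation E tail head"
  shows "laplacian tail head $ i $ j =
    (if i = j then real (vertex_degree E i) else if adjacent E i j then -1 else 0)"
proof -
  let ?f = "\<lambda>e. {tail e, head e}"
  have bij: "bij_betw ?f UNIV E"
    using assms(2) by (simp add: edge_orientation_def)
  have inj: "inj ?f" and E: "E = range ?f"
    using bij by (simp_all add: bij_betw_def)
  have ne: "tail e \<noteq> head e" for e
  proof
    assume "tail e = head e"
    moreover have "card (?f e) = 2"
      using assms(1) unfolding simple_graph_def E by simp
    ultimately show False by simp
  qed
  have S: "laplacian tail head $ i $ j =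
      (\<Sum>e\<in>UNIV. gradient tail head $ e $ i * gradient tail head $ e $ j)"
    by (simp add: laplacian_def matrix_matrix_mult_def transpose_def)
  show ?thesis
  proof (cases "i = j")
    case True
    have img: "f ` {e. i \<in> f e} = {e \<in> range f. i \<in> e}" for f :: "'e \<Rightarrow> 'v set"
      by blast
    have "laplacian tail head $ i $ j = (\<Sum>e\<in>UNIV. if i \<in> ?f e then 1 else 0)"
      unfolding S by (rule sum.cong) (auto simp: True gradient_def)
    also have "\<dots> = real (card {e. i \<in> ?f e})"
      by (simp add: sum.If_cases del: insert_iff)
    also have "card {e. i \<in> ?f e} = card (?f ` {e. i \<in> ?f e})"
      by (rule card_image[symmetric], rule inj_on_subset[OF inj]) simp
    also have "?f ` {e. i \<in> ?f e} = {e \<in> E. i \<in> e}"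
      unfolding E by (rule img)
    finally show ?thesis using True by (simp add: vertex_degree_def)
  next
    case False
    have "gradient tail head $ e $ i * gradient tail head $ e $ j =
        (if ?f e = {i, j} then -1 else 0)" for e
      using False ne[of e] by (auto simp: gradient_def doubleton_eq_iff)
    then have L: "laplacian tail head $ i $ j = - real (card {e. ?f e = {i, j}})"
      unfolding S by (simp add: sum.If_cases)
    show ?thesis
    proof (cases "adjacent E i j")
      case True
      then obtain e0 where e0: "?f e0 = {i, j}"
        unfolding adjacent_def E by (simp only: image_iff) auto
      have "{e. ?f e = {i, j}} = {e0}"
      proof -
        have "e = e0" if "?f e = {i, j}" for e
          by (rule injD[OF inj]) (simp only: that e0)
        with e0 show ?thesis by blast
      qed
      then show ?thesis using L False True by simp
    next
      case nadj: False
      then have "{e. ?f e = {i, j}} = {}"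
        unfolding adjacent_def E by (simp only: image_iff) auto
      then have "laplacian tail head $ i $ j = 0" using L by simp
      then show ?thesis using False nadj by simp
    qed
  qed
qed

end

(* Pairing the equation - Laplacian theta = P with the eigenvector v i gives
   - omega_i^2 theta_i = g_i - l_i, where theta_i = theta \<bullet> v i. Hence
   |gradient theta|^2 = theta \<bullet> Laplacian theta = - theta \<bullet> P = - (\<Sum>i. (g_i - l_i) theta_i),
   whose term for i = 1 vanishes because omega_1 = 0. *)

theory Submission
  imports Defs
begin

text \<open>The transpose is the adjoint for the inner product. With the gradient as
  \<open>A\<close>, this serves both as the energy identity (\<open>x = y\<close>) and as the
  symmetry of the Laplacian.\<close>

lemma inner_transpose_mult_self:
  fixes A :: "real^'n^'m"
  shows "x \<bullet> ((transpose A ** A) *v y) = (A *v x) \<bullet> (A *v y)"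
  by (simp add: matrix_vector_mul_assoc[symmetric] transpose_matrix_vector
      dot_lmul_matrix inner_commute[of x] inner_commute[of "A *v x"])

lemma orthonormal_basis_inner_sum:
  assumes "orthonormal_basis n v" and "i \<in> {1..n}"
  shows "(\<Sum>j=1..n. c j *\<^sub>R v j) \<bullet> v i = c i"
proof -
  have "(\<Sum>j=1..n. c j *\<^sub>R v j) \<bullet> v i = (\<Sum>j=1..n. if j = i then c j else 0)"
    unfolding inner_sum_left
    using assms by (intro sum.cong) (auto simp: orthonormal_basis_def)
  also have "\<dots> = c i"
    using assms(2) by simp
  finally show ?thesis .
qed

theorem mainTheorem2:
  fixes E :: "'v::finite set set"
    and tail head :: "'e::finite \<Rightarrow> 'v"
    and n :: nat
    and \<omega> g l :: "nat \<Rightarrow> real"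
    and v :: "nat \<Rightarrow> real^'v"
    and G L P \<theta> :: "real^'v"
    and P\<^sub>l :: "real^'e"
  assumes "simple_graph E" and "connected_graph E"
    and "n = CARD('v)" and "n \<ge> 2"
    and "edge_orientation E tail head"
    and "(\<omega> 1)\<^sup>2 = 0" and "0 < (\<omega> 2)\<^sup>2"
    and "\<forall>i\<in>{2..<n}. (\<omega> i)\<^sup>2 \<le> (\<omega> (i + 1))\<^sup>2"
    and "orthonormal_basis n v"
    and "\<forall>i\<in>{1..n}. laplacian tail head *v v i = (\<omega> i)\<^sup>2 *\<^sub>R v i"
    and "G = (\<Sum>i=1..n. g i *\<^sub>R v i)" and "L = (\<Sum>i=1..n. l i *\<^sub>R v i)"
    and "P = G - L" and "(\<Sum>k\<in>UNIV. P $ k) = 0"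
    and "- (laplacian tail head *v \<theta>) = P"
    and "P\<^sub>l = gradient tail head *v \<theta>"
  shows "(norm P\<^sub>l)\<^sup>2 = (\<Sum>i=2..n. (g i - l i)\<^sup>2 / (\<omega> i)\<^sup>2)"
proof -
  let ?D = "laplacian tail head"
  have D: "x \<bullet> (?D *v y) = (gradient tail head *v x) \<bullet> (gradient tail head *v y)" for x y
    unfolding laplacian_def by (rule inner_transpose_mult_self)
  have P: "P = (\<Sum>i=1..n. (g i - l i) *\<^sub>R v i)"
    using assms by (simp add: sum_subtractf scaleR_left_diff_distrib)
  have coeff: "g i - l i = - ((\<omega> i)\<^sup>2 * (\<theta> \<bullet> v i))" if "i \<in> {1..n}" for i
  proof -
    have "g i - l i = P \<bullet> v i"
      unfolding P by (rule orthonormal_basis_inner_sum[OF assms(9) that, symmetric])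
    \<comment> \<open>Symmetry moves the Laplacian from \<open>\<theta>\<close> onto
      \<open>v i\<close>: by \<open>D\<close>, both pairings are the inner product of the same two
      gradients.\<close>
    also have "\<dots> = - (\<theta> \<bullet> (?D *v v i))"
      by (simp add: assms(15)[symmetric] D inner_commute[of "?D *v \<theta>"]
          inner_commute[of "gradient tail head *v v i"])
    finally show ?thesis
      using assms(10) that by simp
  qed
  \<comment> \<open>Needed for the divisions in the final sum. Positivity starts at index 2 and
    climbs along the ordering of the eigenvalues; \<open>Suc i \<le> n\<close> puts \<open>i\<close>
    in \<open>{2..<n}\<close>, where that ordering is given.\<close>
  have pos: "0 < (\<omega> i)\<^sup>2" if "2 \<le> i" "i \<le> n" for i
    using that
  proof (induction i rule: dec_induct)
    case base
    show ?case by (rule assms(7))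
  next
    case (step i)
    then have "0 < (\<omega> i)\<^sup>2" by simp
    also have "\<dots> \<le> (\<omega> (Suc i))\<^sup>2"
      using assms(8) step by simp
    finally show ?case .
  qed
  \<comment> \<open>\<open>D\<close> at \<open>x = y = \<theta>\<close>, with the Laplacian of
    \<open>\<theta>\<close> replaced by \<open>- P\<close>.\<close>
  have "(norm P\<^sub>l)\<^sup>2 = - (\<theta> \<bullet> P)"
    by (simp add: assms(15)[symmetric] assms(16) D power2_norm_eq_inner)
  also have "\<dots> = (\<Sum>i=1..n. - ((g i - l i) * (\<theta> \<bullet> v i)))"
    by (simp add: P inner_sum_right sum_negf)
  also have "\<dots> = - ((g 1 - l 1) * (\<theta> \<bullet> v 1)) + (\<Sum>i=2..n. - ((g i - l i) * (\<theta> \<bullet> v i)))"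
    using assms(4) by (simp add: sum.atLeast_Suc_atMost numeral_2_eq_2)
  \<comment> \<open>The zero eigenvalue in \<open>coeff\<close> forces \<open>g 1 = l 1\<close>,
    whatever the component of \<open>\<theta>\<close> along \<open>v 1\<close>.\<close>
  also have "(g 1 - l 1) * (\<theta> \<bullet> v 1) = 0"
    using coeff[of 1] assms(4,6) by simp
  also have "(\<Sum>i=2..n. - ((g i - l i) * (\<theta> \<bullet> v i))) = (\<Sum>i=2..n. (g i - l i)\<^sup>2 / (\<omega> i)\<^sup>2)"
  proof (rule sum.cong)
    fix i assume "i \<in> {2..n}"
    then have "(\<omega> i)\<^sup>2 \<noteq> 0" and "g i - l i = - ((\<omega> i)\<^sup>2 * (\<theta> \<bullet> v i))"
      using pos[of i] coeff[of i] by auto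
    \<comment> \<open>After substituting \<open>coeff\<close>, both sides equal
      \<open>(\<omega> i)\<^sup>2 * (\<theta> \<bullet> v i)\<^sup>2\<close>; the right side cancels
      one nonzero factor \<open>(\<omega> i)\<^sup>2\<close>.\<close>
    then show "- ((g i - l i) * (\<theta> \<bullet> v i)) = (g i - l i)\<^sup>2 / (\<omega> i)\<^sup>2"
      by (simp add: power2_eq_square)
  qed simp
  finally show ?thesis by simp
qed

end
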